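(* Let $\alpha\in(0,1)$, $T,L>0$, and let $\phi,\psi_1,\psi_2$ be positive denominator functions with $\phi(\tau)=\tau^\alpha+\mathcal{O}(\tau^{1+\alpha})$ as $\tau\to0$ and $\psi_i(h)=h^2+\mathcal{O}(h^3)$ as $h\to0$ ($i=1,2$). Let $\tau=T/N$ and $h=L/M$ with $M,N\in\mathbb{Z}^+$, and suppose $$\frac{\phi(\tau)}{\psi_1(h)}+\frac{\phi(\tau)}{\psi_2(h)}\le\frac{1-2^{-\alpha}}{\Gamma(2-\alpha)}.$$ Then the solution $(u_{i,j}^n)$ of the explicit 2D NSFD scheme (defined in the context) satisfies $$\|u^n\|_\infty\le C\left(\|u^0\|_\infty+\max_{1\le n\le N}\|f^{n-1}\|_\infty\right),\qquad n=1,2,\dots,N,$$ where $C$ is a finite positive constant independent of $\tau$ and $h$.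
   Context: The scheme discretizes the problem ${}^{C}D_{0,t}^{\alpha}u=\partial_x^2u+\partial_y^2u+f$ on $[0,L]^2\times(0,T]$, $u(x,y,0)=u^0(x,y)$, $u=0$ on the boundary of $[0,L]^2$, where ${}^{C}D_{0,t}^{\alpha}$ is the Caputo derivative in $t$. Grid: $x_i=ih$, $y_j=jh$ ($0\le i,j\le M$), $t_n=n\tau$ ($0\le n\le N$); $f_{i,j}^n=f(x_i,y_j,t_n)$. Let $b_{k,\alpha}=k^{1-\alpha}-(k-1)^{1-\alpha}$ for $k\ge1$, $\mu_1=\frac{\phi(\tau)\Gamma(2-\alpha)}{\psi_1(h)}$, $\mu_2=\frac{\phi(\tau)\Gamma(2-\alpha)}{\psi_2(h)}$. Explicit 2D NSFD scheme: for $1\le i,j\le M-1$, $1\le n\le N$, $$u_{i,j}^n=\mu_1\left(u_{i+1,j}^{n-1}+u_{i-1,j}^{n-1}\right)+\mu_2\left(u_{i,j+1}^{n-1}+u_{i,j-1}^{n-1}\right)-2(\mu_1+\mu_2)u_{i,j}^{n-1}+\sum_{k=1}^{n-1}(b_{k,\alpha}-b_{k+1,\alpha})u_{i,j}^{n-k}+b_{n,\alpha}u_{i,j}^0+\phi(\tau)\Gamma(2-\alpha)f_{i,j}^{n-1},$$ with $u_{i,j}^0=u^0(x_i,y_j)$ for $0\le i,j\le M$, and $u_{i,j}^n=0$ whenever $i\in\{0,M\}$ or $j\in\{0,M\}$, $0\le n\le N$. Norms: $\|u^n\|_\infty=\max_{1\le i,j\le M-1}|u_{i,j}^n|$ and $\|f^n\|_\infty=\max_{1\le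 i,j\le M-1}|f_{i,j}^n|$. *)

theory Defs
  imports "HOL-Analysis.Analysis" "HOL-Library.Landau_Symbols"
begin

(* L1 weights. The value 0 powr (1 - \<alpha>) = 0 gives b_coeff \<alpha> 1 = 1 for 0 < \<alpha> < 1. *)
definition b_coeff :: "real \<Rightarrow> nat \<Rightarrow> real" where
  "b_coeff \<alpha> k = real k powr (1 - \<alpha>) - real (k - 1) powr (1 - \<alpha>)"

(* Maximum over the interior nodes 1 <= i, j <= M - 1. Inserting 0 leaves the maximum
   of absolute values unchanged and gives 0 when M = 1, where there are no interior nodes. *)
definition grid_norm :: "nat \<Rightarrow> (nat \<Rightarrow> nat \<Rightarrow> real) \<Rightarrow> real" where
  "grid_norm M v = Max (insert 0 ((\<lambda>(i, j). \<bar>v i j\<bar>) ` ({1..M - 1} \<times> {1..M - 1})))"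

definition sample :: "real \<Rightarrow> real \<Rightarrow> (real \<Rightarrow> real \<Rightarrow> real \<Rightarrow> real) \<Rightarrow> nat \<Rightarrow> nat \<Rightarrow> nat \<Rightarrow> real" where
  "sample \<tau> h f n i j = f (real i * h) (real j * h) (real n * \<tau>)"

(* u n i j is the value at time level n and node (i, j); a solution is only constrained for
   n <= N and i, j <= M. *)
definition explicit_nsfd_2d ::
  "real \<Rightarrow> (real \<Rightarrow> real) \<Rightarrow> (real \<Rightarrow> real) \<Rightarrow> (real \<Rightarrow> real) \<Rightarrow> real \<Rightarrow> real \<Rightarrow> nat \<Rightarrow> nat \<Rightarrow>
   (real \<Rightarrow> real \<Rightarrow> real) \<Rightarrow> (real \<Rightarrow> real \<Rightarrow> real \<Rightarrow> real) \<Rightarrow> (nat \<Rightarrow> nat \<Rightarrow> nat \<Rightarrow> real) \<Rightarrow> bool" where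
  "explicit_nsfd_2d \<alpha> \<phi> \<psi>1 \<psi>2 \<tau> h M N u0 f u \<longleftrightarrow>
     (let \<mu>1 = \<phi> \<tau> * Gamma (2 - \<alpha>) / \<psi>1 h;
          \<mu>2 = \<phi> \<tau> * Gamma (2 - \<alpha>) / \<psi>2 h
      in (\<forall>n\<in>{1..N}. \<forall>i\<in>{1..M - 1}. \<forall>j\<in>{1..M - 1}.
            u n i j =
              \<mu>1 * (u (n - 1) (i + 1) j + u (n - 1) (i - 1) j)
              + \<mu>2 * (u (n - 1) i (j + 1) + u (n - 1) i (j - 1))
              - 2 * (\<mu>1 + \<mu>2) * u (n - 1) i j
              + (\<Sum>k = 1..n - 1. (b_coeff \<alpha> k - b_coeff \<alpha> (k + 1)) * u (n - k) i j)
              + b_coeff \<alpha> n * u 0 i j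
              + \<phi> \<tau> * Gamma (2 - \<alpha>) * sample \<tau> h f (n - 1) i j))
     \<and> (\<forall>i\<le>M. \<forall>j\<le>M. u 0 i j = u0 (real i * h) (real j * h))
     \<and> (\<forall>n\<le>N. \<forall>i\<le>M. \<forall>j\<le>M. i \<in> {0, M} \<or> j \<in> {0, M} \<longrightarrow> u n i j = 0)"

end

theory Submission
  imports Defs "HOL-Real_Asymp.Real_Asymp"
begin

text \<open>
  The step restriction says exactly that \<open>2(\<mu>1 + \<mu>2) \<le> b\<^sub>1 - b\<^sub>2\<close>, so every coefficient on the
  right-hand side of the scheme is nonnegative, and the coefficients sum to \<open>1\<close>. Hence the norms
  satisfy a scalar L1 recursion, whose solution is at most \<open>\<parallel>u\<^sup>0\<parallel> + \<phi>(\<tau>) \<Gamma>(2 - \<alpha>) F / b\<^sub>n\<close>. Since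
  \<open>b\<^sub>n \<ge> (1 - \<alpha>) n\<^bsup>-\<alpha>\<^esup>\<close>, the factor of \<open>F\<close> is at most a constant times \<open>\<phi>(\<tau>) N\<^bsup>\<alpha>\<^esup>\<close>, which converges
  as \<open>N\<close> grows and is therefore bounded.
\<close>

section \<open>L1 weights and the scalar L1 recursion\<close>

lemma b_coeff_1 [simp]: "b_coeff \<alpha> (Suc 0) = 1"
  by (simp add: b_coeff_def)

text \<open>Mean value theorem for x^(1 - \<alpha>) on [k, k + 1]. The location of \<open>z\<close>
  yields both estimates used below: z < k + 1 bounds the weight from below, z > k from
  above.\<close>

lemma b_coeff_Suc_mvt:
  assumes "k \<ge> 1"
  obtains z where "real k < z" "z < real (Suc k)" "b_coeff \<alpha> (Suc k) = (1 - \<alpha>) * z powr (- \<alpha>)"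
proof -
  have "\<exists>z. real k < z \<and> z < real (Suc k) \<and>
      real (Suc k) powr (1 - \<alpha>) - real k powr (1 - \<alpha>)
        = (real (Suc k) - real k) * ((1 - \<alpha>) * z powr (- \<alpha>))"
    by (rule MVT2) (use assms in \<open>auto intro!: derivative_eq_intros\<close>)
  then show thesis
    using that by (auto simp: b_coeff_def)
qed

lemma b_coeff_ge:
  assumes "0 < \<alpha>" "\<alpha> < 1" "k \<ge> 1"
  shows "b_coeff \<alpha> k \<ge> (1 - \<alpha>) * real k powr (- \<alpha>)"
\<comment> \<open>For k = 1 the interval would start at 0, where the derivative is singular; there
  b_1 = 1 \<ge> 1 - \<alpha> directly.\<close>
proof (cases "k = 1")
  case False
  then obtain m where m: "k = Suc m" "m \<ge> 1"
    using assms by (cases k) auto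
  obtain z where z: "real m < z" "z < real (Suc m)" "b_coeff \<alpha> (Suc m) = (1 - \<alpha>) * z powr (- \<alpha>)"
    using b_coeff_Suc_mvt[OF m(2)] .
  have "real k powr (- \<alpha>) \<le> z powr (- \<alpha>)"
    using z m assms by (intro powr_mono2') auto
  then show ?thesis
    using z m assms by (simp add: mult_left_mono)
qed (use assms in auto)

text \<open>The value (1 - \<alpha>) k^(-\<alpha>) of the derivative at k separates the two
  weights.\<close>

lemma b_coeff_Suc_le:
  assumes "0 < \<alpha>" "\<alpha> < 1" "k \<ge> 1"
  shows "b_coeff \<alpha> (Suc k) \<le> b_coeff \<alpha> k"
proof -
  obtain z where z: "real k < z" "z < real (Suc k)" "b_coeff \<alpha> (Suc k) = (1 - \<alpha>) * z powr (- \<alpha>)"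
    using b_coeff_Suc_mvt[OF assms(3)] .
  have "z powr (- \<alpha>) \<le> real k powr (- \<alpha>)"
    using z assms by (intro powr_mono2') auto
  then have "b_coeff \<alpha> (Suc k) \<le> (1 - \<alpha>) * real k powr (- \<alpha>)"
    using z assms by (simp add: mult_left_mono)
  with b_coeff_ge[OF assms] show ?thesis by simp
qed

lemma b_coeff_antimono:
  assumes "0 < \<alpha>" "\<alpha> < 1" "1 \<le> k" "k \<le> n"
  shows "b_coeff \<alpha> n \<le> b_coeff \<alpha> k"
  using assms(4)
proof (induction n rule: dec_induct)
  case (step n)
  then show ?case
    using b_coeff_Suc_le[of \<alpha> n] assms by simp
qed simp

lemma b_coeff_pos:
  assumes "0 < \<alpha>" "\<alpha> < 1" "k \<ge> 1"
  shows "b_coeff \<alpha> k > 0"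
proof -
  have "0 < (1 - \<alpha>) * real k powr (- \<alpha>)"
    using assms by simp
  with b_coeff_ge[OF assms] show ?thesis by linarith
qed

text \<open>Telescoping, with b_1 = 1. Together with the weight b_n of the initial value, the
  history weights thus sum to 1.\<close>

lemma sum_b_coeff_diff:
  assumes "n \<ge> 1"
  shows "(\<Sum>k = 1..n - 1. b_coeff \<alpha> k - b_coeff \<alpha> (k + 1)) = 1 - b_coeff \<alpha> n"
  using assms by (induction n rule: dec_induct) (auto simp: sum.nat_ivl_Suc' Suc_le_eq gr0_conv_Suc)

text \<open>Strong induction. As the weights decrease, every earlier bound is at most A_0 + G / b_n.
  Averaging with total weight 1 - b_n loses exactly b_n * (G / b_n) = G, which pays for the source
  term.\<close>

lemma L1_recursion_bound:
  fixes A :: "nat \<Rightarrow> real"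
  assumes \<alpha>: "0 < \<alpha>" "\<alpha> < 1" and "G \<ge> 0"
    and rec: "\<And>n. n \<in> {1..N} \<Longrightarrow>
      A n \<le> (\<Sum>k = 1..n - 1. (b_coeff \<alpha> k - b_coeff \<alpha> (k + 1)) * A (n - k)) + b_coeff \<alpha> n * A 0 + G"
    and "n \<in> {1..N}"
  shows "A n \<le> A 0 + G / b_coeff \<alpha> n"
  using assms(5)
proof (induction n rule: less_induct)
  case (less n)
  let ?b = "b_coeff \<alpha>"
  have n: "n \<ge> 1" "?b n > 0"
    using less.prems b_coeff_pos[OF \<alpha>] by auto
  have "A (n - k) \<le> A 0 + G / ?b n" if "k \<in> {1..n - 1}" for k
  proof -
    have "A (n - k) \<le> A 0 + G / ?b (n - k)"
      using that less by auto
    also have "G / ?b (n - k) \<le> G / ?b n"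
      using that n \<open>G \<ge> 0\<close> b_coeff_pos[OF \<alpha>, of "n - k"] b_coeff_antimono[OF \<alpha>, of "n - k" n]
      by (intro divide_left_mono) auto
    finally show ?thesis by simp
  qed
  then have "(\<Sum>k = 1..n - 1. (?b k - ?b (k + 1)) * A (n - k))
      \<le> (\<Sum>k = 1..n - 1. (?b k - ?b (k + 1)) * (A 0 + G / ?b n))"
    using b_coeff_Suc_le[OF \<alpha>] by (intro sum_mono mult_left_mono) auto
  also have "\<dots> = (1 - ?b n) * (A 0 + G / ?b n)"
    using sum_b_coeff_diff[OF n(1)] by (simp flip: sum_distrib_right)
  finally have "A n \<le> (1 - ?b n) * (A 0 + G / ?b n) + ?b n * A 0 + G"
    using rec[OF less.prems] by linarith
  also have "\<dots> = A 0 + G / ?b n"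
    using n by (simp add: field_simps)
  finally show ?case .
qed

section \<open>Grid norm and the estimate of one time step\<close>

lemma grid_norm_nonneg: "grid_norm M v \<ge> 0"
  unfolding grid_norm_def by (intro Max_ge) auto

lemma abs_le_grid_norm:
  assumes "i \<in> {1..M - 1}" "j \<in> {1..M - 1}"
  shows "\<bar>v i j\<bar> \<le> grid_norm M v"
  unfolding grid_norm_def using assms by (intro Max_ge) (auto intro: rev_image_eqI[of "(i, j)"])

lemma grid_norm_le:
  assumes "B \<ge> 0" "\<And>i j. i \<in> {1..M - 1} \<Longrightarrow> j \<in> {1..M - 1} \<Longrightarrow> \<bar>v i j\<bar> \<le> B"
  shows "grid_norm M v \<le> B"
  unfolding grid_norm_def using assms by (subst Max_le_iff) auto

text \<open>The extra term \<open>c * p\<close> offsets the negative centre coefficient of the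
  stencil: all coefficients become nonnegative and sum to \<open>c\<close>.\<close>

lemma five_point_bound:
  fixes \<mu>1 \<mu>2 c B :: real
  assumes "\<mu>1 \<ge> 0" "\<mu>2 \<ge> 0" "2 * (\<mu>1 + \<mu>2) \<le> c"
    and "\<bar>e\<bar> \<le> B" "\<bar>w\<bar> \<le> B" "\<bar>n\<bar> \<le> B" "\<bar>s\<bar> \<le> B" "\<bar>p\<bar> \<le> B"
  shows "\<bar>\<mu>1 * (e + w) + \<mu>2 * (n + s) - 2 * (\<mu>1 + \<mu>2) * p + c * p\<bar> \<le> c * B"
proof -
  have "\<bar>\<mu>1 * (e + w)\<bar> \<le> \<mu>1 * (2 * B)" "\<bar>\<mu>2 * (n + s)\<bar> \<le> \<mu>2 * (2 * B)"
    using assms by (auto simp: abs_mult intro!: mult_left_mono)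
  moreover have "\<bar>(c - 2 * (\<mu>1 + \<mu>2)) * p\<bar> \<le> (c - 2 * (\<mu>1 + \<mu>2)) * B"
    using assms by (auto simp: abs_mult intro!: mult_left_mono)
  ultimately show ?thesis
    by (simp add: algebra_simps)
qed

lemma explicit_nsfd_2d_step:
  assumes \<alpha>: "0 < \<alpha>" "\<alpha> < 1"
    and pos: "\<phi> \<tau> > 0" "\<psi>1 h > 0" "\<psi>2 h > 0"
    and cfl: "\<phi> \<tau> / \<psi>1 h + \<phi> \<tau> / \<psi>2 h \<le> (1 - 2 powr (- \<alpha>)) / Gamma (2 - \<alpha>)"
    and scheme: "explicit_nsfd_2d \<alpha> \<phi> \<psi>1 \<psi>2 \<tau> h M N u0 f u"
    and n: "n \<in> {1..N}"
  shows "grid_norm M (u n) \<le>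
      (\<Sum>k = 1..n - 1. (b_coeff \<alpha> k - b_coeff \<alpha> (k + 1)) * grid_norm M (u (n - k)))
      + b_coeff \<alpha> n * grid_norm M (u 0)
      + \<phi> \<tau> * Gamma (2 - \<alpha>) * grid_norm M (sample \<tau> h f (n - 1))"
    (is "_ \<le> ?R")
proof (rule grid_norm_le)
  let ?b = "b_coeff \<alpha>" and ?A = "\<lambda>n. grid_norm M (u n)"
  let ?\<Gamma> = "Gamma (2 - \<alpha>)"
  let ?F = "grid_norm M (sample \<tau> h f (n - 1))"
  have \<Gamma>: "?\<Gamma> > 0"
    using \<alpha> by (intro Gamma_real_pos) simp
  have bdiff: "?b k - ?b (k + 1) \<ge> 0" if "k \<ge> 1" for k
    using b_coeff_Suc_le[OF \<alpha> that] by simp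
  have bn: "?b n \<ge> 0"
    using b_coeff_pos[OF \<alpha>, of n] n by simp
  show "0 \<le> ?R"
    using \<Gamma> bdiff bn pos by (intro add_nonneg_nonneg sum_nonneg mult_nonneg_nonneg grid_norm_nonneg) auto
  fix i j assume i: "i \<in> {1..M - 1}" and j: "j \<in> {1..M - 1}"
  define \<mu>1 \<mu>2 where "\<mu>1 = \<phi> \<tau> * ?\<Gamma> / \<psi>1 h" and "\<mu>2 = \<phi> \<tau> * ?\<Gamma> / \<psi>2 h"
  have \<mu>: "\<mu>1 \<ge> 0" "\<mu>2 \<ge> 0"
    using \<Gamma> pos by (auto simp: \<mu>1_def \<mu>2_def)
  have "\<mu>1 + \<mu>2 = ?\<Gamma> * (\<phi> \<tau> / \<psi>1 h + \<phi> \<tau> / \<psi>2 h)"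
    by (simp add: \<mu>1_def \<mu>2_def algebra_simps)
  also have "\<dots> \<le> 1 - 2 powr (- \<alpha>)"
    using mult_left_mono[OF cfl, of ?\<Gamma>] \<Gamma> by simp
  finally have \<mu>_le: "2 * (\<mu>1 + \<mu>2) \<le> 2 - 2 powr (1 - \<alpha>)"
    by (simp add: powr_diff powr_minus divide_inverse)
  \<comment> \<open>Hence the right-hand side of \<open>\<mu>_le\<close> is b_1 - b_2.\<close>
  have b2: "?b 2 = 2 powr (1 - \<alpha>) - 1"
    by (simp add: b_coeff_def)
  have b2_pos: "?b 2 \<ge> 0"
    using b_coeff_pos[OF \<alpha>, of 2] by simp
  have bdry: "u m a b = 0" if "m \<le> N" "a \<le> M" "b \<le> M" "a \<in> {0, M} \<or> b \<in> {0, M}" for m a b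
    using scheme that unfolding explicit_nsfd_2d_def by blast
  \<comment> \<open>Stencil neighbours may lie on the boundary, which \<open>grid_norm\<close> does
    not see; the boundary condition covers them.\<close>
  have nb: "\<bar>u (n - 1) a b\<bar> \<le> ?A (n - 1)" if "a \<le> M" "b \<le> M" for a b
  proof (cases "a \<in> {0, M} \<or> b \<in> {0, M}")
    case True
    then show ?thesis
      using bdry[of "n - 1" a b] that n by (auto simp: grid_norm_nonneg)
  next
    case False
    then show ?thesis
      using that by (intro abs_le_grid_norm) auto
  qed
  define st where "st = \<mu>1 * (u (n - 1) (i + 1) j + u (n - 1) (i - 1) j)
      + \<mu>2 * (u (n - 1) i (j + 1) + u (n - 1) i (j - 1)) - 2 * (\<mu>1 + \<mu>2) * u (n - 1) i j"
  \<comment> \<open>\<open>c\<close> stays free: it is the weight with which u^(n-1) enters outside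
    the stencil, namely 1 for n = 1 and b_1 - b_2 for n \<ge> 2.\<close>
  have st: "\<bar>st + c * u (n - 1) i j\<bar> \<le> c * ?A (n - 1)" if "2 * (\<mu>1 + \<mu>2) \<le> c" for c
    unfolding st_def using that \<mu> i j by (intro five_point_bound nb) auto
  have u_eq: "u n i j = st + (\<Sum>k = 1..n - 1. (?b k - ?b (k + 1)) * u (n - k) i j)
      + ?b n * u 0 i j + \<phi> \<tau> * ?\<Gamma> * sample \<tau> h f (n - 1) i j"
    using scheme n i j unfolding explicit_nsfd_2d_def Let_def st_def \<mu>1_def \<mu>2_def by blast
  have src: "\<bar>\<phi> \<tau> * ?\<Gamma> * sample \<tau> h f (n - 1) i j\<bar> \<le> \<phi> \<tau> * ?\<Gamma> * ?F"
    using \<Gamma> pos abs_le_grid_norm[OF i j, of "sample \<tau> h f (n - 1)"]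
    by (simp add: abs_mult mult_left_mono)
  have init: "\<bar>?b n * u 0 i j\<bar> \<le> ?b n * ?A 0"
    using bn abs_le_grid_norm[OF i j, of "u 0"] by (simp add: abs_mult mult_left_mono)
  show "\<bar>u n i j\<bar> \<le> ?R"
  proof (cases "n = 1")
    case True
    \<comment> \<open>The history sum is empty here, and level n - 1 is the initial level, whose
      weight is b_1 = 1.\<close>
    have "2 * (\<mu>1 + \<mu>2) \<le> 1"
      using \<mu>_le b2 b2_pos by linarith
    from st[OF this] True src u_eq show ?thesis by simp
  next
    case False
    \<comment> \<open>The term k = 1 carries u^(n-1) and is grouped with the stencil.\<close>
    have split: "(\<Sum>k = 1..n - 1. g k) = g 1 + (\<Sum>k = 2..n - 1. g k)" for g :: "nat \<Rightarrow> real"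
      using False n by (subst sum.atLeast_Suc_atMost) (auto simp: numeral_2_eq_2)
    have "2 * (\<mu>1 + \<mu>2) \<le> ?b 1 - ?b (1 + 1)"
      using \<mu>_le b2 by (simp add: numeral_2_eq_2)
    note st1 = st[OF this]
    have hist: "\<bar>\<Sum>k = 2..n - 1. (?b k - ?b (k + 1)) * u (n - k) i j\<bar>
        \<le> (\<Sum>k = 2..n - 1. (?b k - ?b (k + 1)) * ?A (n - k))"
    proof (rule order_trans[OF sum_abs sum_mono])
      fix k assume "k \<in> {2..n - 1}"
      then show "\<bar>(?b k - ?b (k + 1)) * u (n - k) i j\<bar> \<le> (?b k - ?b (k + 1)) * ?A (n - k)"
        using bdiff[of k] abs_le_grid_norm[OF i j, of "u (n - k)"]
        by (simp add: abs_mult mult_left_mono)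
    qed
    show ?thesis
      unfolding u_eq split using st1 hist init src by linarith
  qed
qed

section \<open>Scaled denominator and the uniform constant\<close>

lemma denominator_scaled_bounded:
  fixes T \<alpha> :: real
  assumes "T > 0"
    and "(\<lambda>\<tau>. \<phi> \<tau> - \<tau> powr \<alpha>) \<in> O[at_right 0](\<lambda>\<tau>. \<tau> powr (1 + \<alpha>))"
  shows "Bseq (\<lambda>N. \<phi> (T / real N) * real N powr \<alpha>)"
proof -
  \<comment> \<open>The error term is of higher order, so \<phi> itself is O(\<tau>^\<alpha>); at
    \<tau> = T / N this is a multiple of T^\<alpha> N^(-\<alpha>).\<close>
  have "(\<lambda>\<tau>. \<tau> powr (1 + \<alpha>)) \<in> O[at_right 0](\<lambda>\<tau>::real. \<tau> powr \<alpha>)"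
    by real_asymp
  with assms(2) have "(\<lambda>\<tau>. \<phi> \<tau> - \<tau> powr \<alpha>) \<in> O[at_right 0](\<lambda>\<tau>. \<tau> powr \<alpha>)"
    by (rule landau_o.big_trans)
  then have "(\<lambda>\<tau>. (\<phi> \<tau> - \<tau> powr \<alpha>) + \<tau> powr \<alpha>) \<in> O[at_right 0](\<lambda>\<tau>. \<tau> powr \<alpha>)"
    by (rule sum_in_bigo) simp
  then obtain c where c: "\<forall>\<^sub>F \<tau> in at_right 0. norm (\<phi> \<tau>) \<le> c * norm (\<tau> powr \<alpha>)"
    by (auto elim: landau_o.bigE)
  have "filterlim (\<lambda>N. T / real N) (at_right 0) sequentially"
    using assms(1) by real_asymp
  with c have "\<forall>\<^sub>F N in sequentially. norm (\<phi> (T / real N)) \<le> c * norm ((T / real N) powr \<alpha>)"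
    by (rule eventually_compose_filterlim)
  then have "\<forall>\<^sub>F N in sequentially. norm (\<phi> (T / real N) * real N powr \<alpha>) \<le> c * T powr \<alpha>"
    using eventually_gt_at_top[of 0]
  proof eventually_elim
    case (elim N)
    then show ?case
      using assms(1) by (simp add: powr_divide abs_mult field_simps)
  qed
  \<comment> \<open>A bound for all large N suffices for \<open>Bseq\<close>: the finitely many
    other N only enlarge the constant.\<close>
  then show ?thesis
    by (rule BfunI)
qed

theorem theorem5p2:
  fixes \<alpha> T L :: real and \<phi> \<psi>1 \<psi>2 :: "real \<Rightarrow> real"
  assumes "0 < \<alpha>" and "\<alpha> < 1" and "T > 0" and "L > 0"
    and "\<And>\<tau>. 0 < \<tau> \<Longrightarrow> \<tau> \<le> T \<Longrightarrow> \<phi> \<tau> > 0"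
    and "\<And>h. 0 < h \<Longrightarrow> h \<le> L \<Longrightarrow> \<psi>1 h > 0"
    and "\<And>h. 0 < h \<Longrightarrow> h \<le> L \<Longrightarrow> \<psi>2 h > 0"
    and "(\<lambda>\<tau>. \<phi> \<tau> - \<tau> powr \<alpha>) \<in> O[at_right 0](\<lambda>\<tau>. \<tau> powr (1 + \<alpha>))"
    and "(\<lambda>h. \<psi>1 h - h ^ 2) \<in> O[at_right 0](\<lambda>h. h ^ 3)"
    and "(\<lambda>h. \<psi>2 h - h ^ 2) \<in> O[at_right 0](\<lambda>h. h ^ 3)"
  shows "\<exists>C::real. C > 0 \<and>
    (\<forall>(M::nat) (N::nat) (\<tau>::real) (h::real)
        (u0 :: real \<Rightarrow> real \<Rightarrow> real) (f :: real \<Rightarrow> real \<Rightarrow> real \<Rightarrow> real)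
        (u :: nat \<Rightarrow> nat \<Rightarrow> nat \<Rightarrow> real).
       M \<ge> 1 \<longrightarrow> N \<ge> 1 \<longrightarrow> \<tau> = T / real N \<longrightarrow> h = L / real M \<longrightarrow>
       \<phi> \<tau> / \<psi>1 h + \<phi> \<tau> / \<psi>2 h \<le> (1 - 2 powr (- \<alpha>)) / Gamma (2 - \<alpha>) \<longrightarrow>
       explicit_nsfd_2d \<alpha> \<phi> \<psi>1 \<psi>2 \<tau> h M N u0 f u \<longrightarrow>
       (\<forall>n\<in>{1..N}. grid_norm M (u n)
          \<le> C * (grid_norm M (u 0) + (MAX n\<in>{1..N}. grid_norm M (sample \<tau> h f (n - 1))))))"
proof -
  note \<alpha> = assms(1,2)
  let ?\<Gamma> = "Gamma (2 - \<alpha>)"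
  have \<Gamma>: "?\<Gamma> > 0"
    using \<alpha> by (intro Gamma_real_pos) simp
  obtain K where K: "K > 0" "\<And>N. norm (\<phi> (T / real N) * real N powr \<alpha>) \<le> K"
    using denominator_scaled_bounded[OF assms(3,8)] by (auto elim: BseqE)
  \<comment> \<open>The entry 1 serves the initial norm, the other the source. \<open>K\<close> was
    fixed before M, N and the data, so \<open>C\<close> does not depend on them.\<close>
  define C where "C = max 1 (?\<Gamma> * K / (1 - \<alpha>))"
  have bound: "grid_norm M (u n)
      \<le> C * (grid_norm M (u 0) + (MAX n\<in>{1..N}. grid_norm M (sample (T / real N) (L / real M) f (n - 1))))"
    if M: "M \<ge> 1" and N: "N \<ge> 1"
      and cfl: "\<phi> (T / real N) / \<psi>1 (L / real M) + \<phi> (T / real N) / \<psi>2 (L / real M)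
        \<le> (1 - 2 powr (- \<alpha>)) / ?\<Gamma>"
      and scheme: "explicit_nsfd_2d \<alpha> \<phi> \<psi>1 \<psi>2 (T / real N) (L / real M) M N u0 f u"
      and n: "n \<in> {1..N}"
    for M N n :: nat and u0 f u
  proof -
    define \<tau> h where "\<tau> = T / real N" and "h = L / real M"
    have \<tau>: "0 < \<tau>" "\<tau> \<le> T" and h: "0 < h" "h \<le> L"
      using M N assms(3,4) by (auto simp: \<tau>_def h_def field_simps)
    note pos = assms(5)[OF \<tau>] assms(6,7)[OF h]
    define F where "F = (MAX n\<in>{1..N}. grid_norm M (sample \<tau> h f (n - 1)))"
    have F: "grid_norm M (sample \<tau> h f (m - 1)) \<le> F" if "m \<in> {1..N}" for m
      unfolding F_def using that by (intro Max_ge) auto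
    have F0: "F \<ge> 0"
      using F[OF n] grid_norm_nonneg[of M "sample \<tau> h f (n - 1)"] by linarith
    have step: "grid_norm M (u m) \<le>
        (\<Sum>k = 1..m - 1. (b_coeff \<alpha> k - b_coeff \<alpha> (k + 1)) * grid_norm M (u (m - k)))
        + b_coeff \<alpha> m * grid_norm M (u 0) + \<phi> \<tau> * ?\<Gamma> * F" if m: "m \<in> {1..N}" for m
    proof -
      have "\<phi> \<tau> * ?\<Gamma> * grid_norm M (sample \<tau> h f (m - 1)) \<le> \<phi> \<tau> * ?\<Gamma> * F"
        using F[OF m] pos \<Gamma> by (intro mult_left_mono) auto
      with explicit_nsfd_2d_step[OF \<alpha> pos cfl[folded \<tau>_def h_def] scheme[folded \<tau>_def h_def] m]
      show ?thesis by linarith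
    qed
    have "grid_norm M (u n) \<le> grid_norm M (u 0) + \<phi> \<tau> * ?\<Gamma> * F / b_coeff \<alpha> n"
      using pos \<Gamma> F0 by (intro L1_recursion_bound[OF \<alpha> _ step n]) auto
    \<comment> \<open>Passing from b_n to the smallest weight b_N makes the bound uniform in n and
      pairs \<phi>(T / N) with N^\<alpha>, the product that \<open>K\<close> bounds.\<close>
    also have "\<phi> \<tau> * ?\<Gamma> * F / b_coeff \<alpha> n \<le> \<phi> \<tau> * ?\<Gamma> * F / ((1 - \<alpha>) * real N powr (- \<alpha>))"
    proof (rule divide_left_mono)
      have "(1 - \<alpha>) * real N powr (- \<alpha>) \<le> b_coeff \<alpha> N"
        using b_coeff_ge[OF \<alpha> N] .
      also have "\<dots> \<le> b_coeff \<alpha> n"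
        using b_coeff_antimono[OF \<alpha>, of n N] n by simp
      finally show "(1 - \<alpha>) * real N powr (- \<alpha>) \<le> b_coeff \<alpha> n" .
    qed (use \<alpha> N n pos \<Gamma> F0 b_coeff_pos[OF \<alpha>, of n] in auto)
    also have "\<dots> = (?\<Gamma> * (\<phi> \<tau> * real N powr \<alpha>) / (1 - \<alpha>)) * F"
      by (simp add: powr_minus field_simps)
    also have "\<dots> \<le> (?\<Gamma> * K / (1 - \<alpha>)) * F"
      using K(2)[of N] \<alpha> \<Gamma> F0
      by (intro mult_right_mono divide_right_mono mult_left_mono) (auto simp: \<tau>_def)
    also have "\<dots> \<le> C * F"
      using F0 by (intro mult_right_mono) (auto simp: C_def)
    also have "grid_norm M (u 0) \<le> C * grid_norm M (u 0)"
      using mult_right_mono[of 1 C "grid_norm M (u 0)"] grid_norm_nonneg[of M "u 0"]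
      by (simp add: C_def)
    finally show ?thesis
      by (simp add: F_def \<tau>_def h_def distrib_left)
  qed
  show ?thesis
    by (rule exI[of _ C]) (use bound in \<open>auto simp: C_def\<close>)
qed

end
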